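(* Let $\Bbbk$ be a field, $A$ a $\Bbbk$-algebra, $\sigma:A\to M_n(A)$ an algebra map, and $\delta=(\delta_1,\ldots,\delta_n)\in A^n$. Let $\partial:A\to A^n$ be given by $\partial_i(a)=\sum_j\delta_j\sigma_{ji}(a)-a\delta_i$, $i=1,\ldots,n$. Suppose that $(\partial,\sigma;\bar\sigma,\hat\sigma)$ is a free right twisted multi-derivation and let $\Lambda$ be the integral on $A$ relative to it. Then, for all $a\in A$ and $i=1,2,\ldots,n$, $$\Lambda\Big(\sum_{k,l}\bar\sigma_{kl}(\delta_l)\,\hat\sigma_{ki}(a)\Big)=\Lambda\Big(\sum_l a\,\bar\sigma_{il}(\delta_l)\Big).$$
   Context: All algebras are associative and unital over $\Bbbk$. $\mathrm{Hom}_A$ denotes right $A$-module maps. For $\sigma:A\to M_n(A)$ write $\sigma(a)=(\sigma_{ij}(a))$; for $\partial:A\to A^n$ write $\partial(a)=(\partial_i(a))$. Right twisted multi-derivation: a pair $(\partial,\sigma)$ of $\Bbbk$-linear maps $\partial:A\to A^n$, $\sigma:A\to M_n(A)$ with $\partial_i(ab)=\sum_j\partial_j(a)\sigma_{ji}(b)+a\partial_i(b)$ for all $a,b\in A$, $i=1,\ldots,n$. (The $\partial$ of the claim satisfies this.) Free right twisted multi-derivation $(\partial,\sigma;\bar\sigma,\hat\sigma)$: a right twisted multi-derivation $(\partial,\sigma)$ in which $\sigma$ is a unital algebra map, together with an algebra map $\bar\sigma:A\to M_n(A)$ and a $\Bbbk$-linear map $\hat\sigma:A\to M_n(A)$ such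 that for all $a\in A$ and all $i,j$: $$\sum_k\bar\sigma_{ik}(\sigma_{jk}(a))=\delta_{ij}a,\quad \sum_k\sigma_{ki}(\bar\sigma_{kj}(a))=\delta_{ij}a,\quad \sum_k\hat\sigma_{ik}(\bar\sigma_{jk}(a))=\delta_{ij}a,\quad \sum_k\bar\sigma_{ki}(\hat\sigma_{kj}(a))=\delta_{ij}a$$ (here $\delta_{ij}$ with two indices is the Kronecker delta). The associated first order differential calculus $\Omega^1(A)$ is the free left $A$-module with basis $\omega_1,\ldots,\omega_n$, with right action determined by $\omega_i a=\sum_j\sigma_{ij}(a)\omega_j$, and differential $da=\sum_i\partial_i(a)\omega_i$. Put $\partial_i^\sigma:=\sum_{j,k}\bar\sigma_{kj}\circ\partial_j\circ\hat\sigma_{ki}$ and $$\nabla:\mathrm{Hom}_A(\Omega^1(A),A)\to A,\qquad f\mapsto\sum_i\partial_i^\sigma(f(\omega_i)).$$ The integral on $A$ relative to $(\partial,\sigma;\bar\sigma,\hat\sigma)$ is the cokernel map $\Lambda:A\to\mathrm{coker}\,\nabla=A/\mathrm{im}\,\nabla$. *)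

theory Defs
  imports "HOL-Analysis.Finite_Cartesian_Product" "HOL-Library.Set_Algebras"
begin

(* The sort {ring, monoid_mult} is "associative unital ring"; ring_1 would in addition
   exclude the zero ring.  As a consequence the matrix product of the library
   (which needs semiring_1) is written out entrywise below. *)

locale k_algebra = vector_space smul
  for smul :: "'k::field \<Rightarrow> 'a::{ring,monoid_mult} \<Rightarrow> 'a" +
  assumes scale_mult_left: "smul c (a * b) = smul c a * b"
    and scale_mult_right: "smul c (a * b) = a * smul c b"

definition vec_scale :: "('k \<Rightarrow> 'a \<Rightarrow> 'a) \<Rightarrow> 'k \<Rightarrow> 'a ^ 'n \<Rightarrow> 'a ^ 'n"
  where "vec_scale smul c v = (\<chi> i. smul c (v $ i))"

definition mat_scale :: "('k \<Rightarrow> 'a \<Rightarrow> 'a) \<Rightarrow> 'k \<Rightarrow> 'a ^ 'n ^ 'n \<Rightarrow> 'a ^ 'n ^ 'n"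
  where "mat_scale smul c M = (\<chi> i j. smul c (M $ i $ j))"

lemma (in k_algebra) vector_space_vec_scale: "vector_space (vec_scale smul)"
  by unfold_locales
    (simp_all add: vec_scale_def vec_eq_iff scale_right_distrib scale_left_distrib)

lemma (in k_algebra) vector_space_mat_scale: "vector_space (mat_scale smul)"
  by unfold_locales
    (simp_all add: mat_scale_def vec_eq_iff scale_right_distrib scale_left_distrib)

locale matrix_algebra_map = k_algebra smul + Vector_Spaces.linear smul "mat_scale smul" \<tau>
  for smul :: "'k::field \<Rightarrow> 'a::{ring,monoid_mult} \<Rightarrow> 'a" and \<tau> :: "'a \<Rightarrow> 'a ^ 'n ^ 'n" +
  assumes map_mult: "\<tau> (a * b) = (\<chi> i j. \<Sum>k\<in>UNIV. \<tau> a $ i $ k * \<tau> b $ k $ j)"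
    and map_one: "\<tau> 1 = mat 1"

locale right_twisted_multi_derivation =
  k_algebra smul +
  der: Vector_Spaces.linear smul "vec_scale smul" der +
  sig: Vector_Spaces.linear smul "mat_scale smul" \<sigma>
  for smul :: "'k::field \<Rightarrow> 'a::{ring,monoid_mult} \<Rightarrow> 'a"
    and der :: "'a \<Rightarrow> 'a ^ 'n" and \<sigma> :: "'a \<Rightarrow> 'a ^ 'n ^ 'n" +
  assumes twisted_Leibniz:
    "der (a * b) $ i = (\<Sum>j\<in>UNIV. der a $ j * \<sigma> b $ j $ i) + a * der b $ i"

locale free_right_twisted_multi_derivation =
  right_twisted_multi_derivation smul der \<sigma> +
  sig: matrix_algebra_map smul \<sigma> +
  bar: matrix_algebra_map smul \<sigma>bar +
  hat: Vector_Spaces.linear smul "mat_scale smul" \<sigma>hat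
  for smul :: "'k::field \<Rightarrow> 'a::{ring,monoid_mult} \<Rightarrow> 'a"
    and der :: "'a \<Rightarrow> 'a ^ 'n" and \<sigma> \<sigma>bar \<sigma>hat :: "'a \<Rightarrow> 'a ^ 'n ^ 'n" +
  assumes bar_sig: "(\<Sum>k\<in>UNIV. \<sigma>bar (\<sigma> a $ j $ k) $ i $ k) = (if i = j then a else 0)"
    and sig_bar: "(\<Sum>k\<in>UNIV. \<sigma> (\<sigma>bar a $ k $ j) $ k $ i) = (if i = j then a else 0)"
    and hat_bar: "(\<Sum>k\<in>UNIV. \<sigma>hat (\<sigma>bar a $ j $ k) $ i $ k) = (if i = j then a else 0)"
    and bar_hat: "(\<Sum>k\<in>UNIV. \<sigma>bar (\<sigma>hat a $ k $ j) $ k $ i) = (if i = j then a else 0)"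

(* The bimodule of one-forms is realised on the type 'a ^ 'n: the left action is the library's
   scalar multiplication a *s w, and w $ i is the coefficient of the basis form omega i. *)

definition omega :: "'n \<Rightarrow> ('a::{ring,monoid_mult}) ^ 'n"
  where "omega i = axis i 1"

definition form_right_action ::
    "('a::{ring,monoid_mult} \<Rightarrow> 'a ^ 'n ^ 'n) \<Rightarrow> 'a ^ 'n \<Rightarrow> 'a \<Rightarrow> 'a ^ 'n"
  where "form_right_action \<sigma> w a = (\<Sum>i\<in>UNIV. w $ i *s (\<Sum>j\<in>UNIV. \<sigma> a $ i $ j *s omega j))"

lemma form_right_action_nth:
  "form_right_action \<sigma> w a $ j = (\<Sum>i\<in>UNIV. w $ i * \<sigma> a $ i $ j)"
  by (simp add: form_right_action_def omega_def axis_def if_distrib cong: if_cong)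

lemma form_right_action_omega:
  "form_right_action \<sigma> (omega i) a = (\<Sum>j\<in>UNIV. \<sigma> a $ i $ j *s omega j)"
proof -
  have *: "(\<Sum>l\<in>UNIV. (if l = k then 1 else 0) * x l) = (x k :: 'a)"
    "(\<Sum>l\<in>UNIV. x l * (if k = l then 1 else 0)) = x k" for k :: 'b and x
    by (simp_all add: if_distrib[of "\<lambda>y. y * _"] if_distrib[of "\<lambda>y. _ * y"] cong: if_cong)
  show ?thesis
    unfolding vec_eq_iff form_right_action_nth
    by (simp add: omega_def axis_def *)
qed

definition form_Hom ::
    "('a::{ring,monoid_mult} \<Rightarrow> 'a ^ 'n ^ 'n) \<Rightarrow> ('a ^ 'n \<Rightarrow> 'a) set"
  where "form_Hom \<sigma> = {f. (\<forall>v w. f (v + w) = f v + f w) \<and>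
                          (\<forall>w a. f (form_right_action \<sigma> w a) = f w * a)}"

definition partial_sigma ::
    "('a::{ring,monoid_mult} \<Rightarrow> 'a ^ 'n) \<Rightarrow> ('a \<Rightarrow> 'a ^ 'n ^ 'n) \<Rightarrow> ('a \<Rightarrow> 'a ^ 'n ^ 'n) \<Rightarrow> 'n \<Rightarrow> 'a \<Rightarrow> 'a"
  where "partial_sigma der \<sigma>bar \<sigma>hat i a =
    (\<Sum>j\<in>UNIV. \<Sum>k\<in>UNIV. \<sigma>bar (der (\<sigma>hat a $ k $ i) $ j) $ k $ j)"

(* The map nabla; only its restriction to form_Hom matters. *)
definition divergence ::
    "('a::{ring,monoid_mult} \<Rightarrow> 'a ^ 'n) \<Rightarrow> ('a \<Rightarrow> 'a ^ 'n ^ 'n) \<Rightarrow> ('a \<Rightarrow> 'a ^ 'n ^ 'n) \<Rightarrow>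
      ('a ^ 'n \<Rightarrow> 'a) \<Rightarrow> 'a"
  where "divergence der \<sigma>bar \<sigma>hat f = (\<Sum>i\<in>UNIV. partial_sigma der \<sigma>bar \<sigma>hat i (f (omega i)))"

(* Lambda: the quotient map of A by the subspace im nabla; its values are the cosets of im nabla. *)
definition integral_map ::
    "('a::{ring,monoid_mult} \<Rightarrow> 'a ^ 'n) \<Rightarrow> ('a \<Rightarrow> 'a ^ 'n ^ 'n) \<Rightarrow> ('a \<Rightarrow> 'a ^ 'n ^ 'n) \<Rightarrow>
      ('a \<Rightarrow> 'a ^ 'n ^ 'n) \<Rightarrow> 'a \<Rightarrow> 'a set"
  where "integral_map der \<sigma> \<sigma>bar \<sigma>hat a = a +o (divergence der \<sigma>bar \<sigma>hat ` form_Hom \<sigma>)"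

context free_right_twisted_multi_derivation
begin

lemma form_right_action_mult:
  "form_right_action \<sigma> (form_right_action \<sigma> w a) b = form_right_action \<sigma> w (a * b)"
proof -
  have "(\<Sum>i\<in>UNIV. (\<Sum>l\<in>UNIV. w $ l * \<sigma> a $ l $ i) * \<sigma> b $ i $ j)
      = (\<Sum>l\<in>UNIV. w $ l * (\<Sum>i\<in>UNIV. \<sigma> a $ l $ i * \<sigma> b $ i $ j))" for j
    unfolding sum_distrib_left sum_distrib_right mult.assoc by (rule sum.swap)
  then show ?thesis
    by (simp add: vec_eq_iff form_right_action_nth sig.map_mult)
qed

lemma form_right_action_one: "form_right_action \<sigma> w 1 = w"
proof -
  have "x * (if i = j then 1 else 0) = (if i = j then x else (0::'a))" for i j :: 'n and x
    by simp
  then show ?thesis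
    by (simp add: vec_eq_iff form_right_action_nth sig.map_one mat_def)
qed

lemma subspace_im_divergence: "subspace (divergence der \<sigma>bar \<sigma>hat ` form_Hom \<sigma>)"
proof -
  let ?D = "divergence der \<sigma>bar \<sigma>hat"
  have add: "?D (\<lambda>w. f w + g w) = ?D f + ?D g" for f g
    by (simp add: divergence_def partial_sigma_def hat.add der.add bar.add sum.distrib)
  have scl: "?D (\<lambda>w. smul c (f w)) = smul c (?D f)" for c f
    by (simp add: divergence_def partial_sigma_def hat.scale der.scale bar.scale
        mat_scale_def vec_scale_def scale_sum_right)
  have "?D (\<lambda>w. smul 0 (0::'a)) = smul 0 (?D (\<lambda>w. 0))"
    by (rule scl)
  then have zero: "?D (\<lambda>w. 0) = 0"
    by simp
  have "0 \<in> ?D ` form_Hom \<sigma>"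
    by (rule image_eqI[where f = ?D, OF zero[symmetric]]) (simp add: form_Hom_def)
  moreover have "?D f + ?D g \<in> ?D ` form_Hom \<sigma>" if "f \<in> form_Hom \<sigma>" "g \<in> form_Hom \<sigma>" for f g
    by (rule image_eqI[where f = ?D, OF add[symmetric]]) (use that in \<open>simp add: form_Hom_def algebra_simps\<close>)
  moreover have "smul c (?D f) \<in> ?D ` form_Hom \<sigma>" if "f \<in> form_Hom \<sigma>" for f c
    by (rule image_eqI[where f = ?D, OF scl[symmetric]])
      (use that in \<open>simp add: form_Hom_def scale_right_distrib scale_mult_left\<close>)
  ultimately show ?thesis
    by (auto intro!: subspaceI)
qed

lemma integral_map_eq_iff:
  "integral_map der \<sigma> \<sigma>bar \<sigma>hat a = integral_map der \<sigma> \<sigma>bar \<sigma>hat b \<longleftrightarrow>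
    a - b \<in> divergence der \<sigma>bar \<sigma>hat ` form_Hom \<sigma>"
proof -
  have coset: "a +o S = b +o S \<longleftrightarrow> a - b \<in> S" if S: "subspace S" for S
  proof
    assume "a +o S = b +o S"
    moreover have "a \<in> a +o S"
      using subspace_0[OF S] by (auto simp: elt_set_plus_def)
    ultimately show "a - b \<in> S"
      by (auto simp: elt_set_plus_def)
  next
    assume *: "a - b \<in> S"
    have "\<exists>t\<in>S. a + s = b + t" if "s \<in> S" for s
      using subspace_add[OF S * that] by (intro bexI[of _ "(a - b) + s"]) simp_all
    moreover have "\<exists>t\<in>S. b + s = a + t" if "s \<in> S" for s
      using subspace_diff[OF S that *] by (intro bexI[of _ "s - (a - b)"]) simp_all
    ultimately show "a +o S = b +o S"
      unfolding elt_set_plus_def by auto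
  qed
  show ?thesis
    unfolding integral_map_def by (rule coset[OF subspace_im_divergence])
qed

end

end

theory Submission
  imports Defs
begin

text \<open>
  The difference of the two arguments of \<open>\<Lambda>\<close> is not merely in the image of \<open>\<nabla>\<close>: it is exactly
  \<open>\<partial>\<^sub>i\<^sup>\<sigma>(a)\<close>. To see this, substitute the inner formula for \<open>\<partial>\<close> into
  \<open>\<partial>\<^sub>i\<^sup>\<sigma>(a) = \<Sum>\<^sub>j\<^sub>k \<sigma>bar\<^sub>k\<^sub>j(\<partial>\<^sub>j(\<sigma>hat\<^sub>k\<^sub>i(a)))\<close> and use multiplicativity of \<open>\<sigma>bar\<close>. In the summand
  \<open>\<delta>\<^sub>l \<sigma>\<^sub>l\<^sub>j(\<sigma>hat\<^sub>k\<^sub>i(a))\<close> the sum over \<open>j\<close> cancels \<open>\<sigma>\<close> against \<open>\<sigma>bar\<close> (\<open>sum_bar_mult_sig\<close>), while in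
  \<open>\<sigma>hat\<^sub>k\<^sub>i(a) \<delta>\<^sub>j\<close> the sum over \<open>k\<close> cancels \<open>\<sigma>hat\<close> against \<open>\<sigma>bar\<close> (\<open>sum_bar_hat_mult\<close>); what
  remains are the two arguments.

  Every \<open>\<partial>\<^sub>i\<^sup>\<sigma>(a)\<close> lies in the image of \<open>\<nabla>\<close> because \<open>\<omega>\<^sub>1, \<dots>, \<omega>\<^sub>n\<close> is also a basis of the right
  module of one-forms: as \<open>a \<omega>\<^sub>j = \<Sum>\<^sub>k \<omega>\<^sub>k \<sigma>bar\<^sub>k\<^sub>j(a)\<close>, the \<open>i\<close>-th right coordinate of a form \<open>w\<close> is
  \<open>\<Sum>\<^sub>j \<sigma>bar\<^sub>i\<^sub>j(w\<^sub>j)\<close>. Multiplying it by \<open>a\<close> on the left gives a right linear map (\<open>dual_form\<close>) with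
  value \<open>a\<close> at \<open>\<omega>\<^sub>i\<close> and \<open>0\<close> at the other basis forms, so that \<open>\<nabla>\<close> sends it to \<open>\<partial>\<^sub>i\<^sup>\<sigma>(a)\<close>.
\<close>

definition dual_form ::
    "('a::{ring,monoid_mult} \<Rightarrow> 'a ^ 'n ^ 'n) \<Rightarrow> 'n \<Rightarrow> 'a \<Rightarrow> 'a ^ 'n \<Rightarrow> 'a"
  where "dual_form \<sigma>bar i a w = a * (\<Sum>j\<in>UNIV. \<sigma>bar (w $ j) $ i $ j)"

lemma sum_mult_delta:
  fixes x :: "'n::finite \<Rightarrow> 'a::ring"
  shows "(\<Sum>m\<in>UNIV. x m * (if m = l then b else 0)) = x l * b"
    and "(\<Sum>m\<in>UNIV. (if m = l then b else 0) * x m) = b * x l"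
  by (simp_all add: if_distrib[of "\<lambda>y. _ * y"] if_distrib[of "\<lambda>y. y * _"] cong: if_cong)

context free_right_twisted_multi_derivation
begin

lemma bar_mult_nth:
  "\<sigma>bar (a * b) $ i $ j = (\<Sum>m\<in>UNIV. \<sigma>bar a $ i $ m * \<sigma>bar b $ m $ j)"
  by (simp add: bar.map_mult)

lemma bar_sum_nth: "\<sigma>bar (\<Sum>x\<in>S. f x) $ i $ j = (\<Sum>x\<in>S. \<sigma>bar (f x) $ i $ j)"
  by (simp add: bar.sum)

text \<open>
  This one cancellation of \<open>\<sigma>\<close> against \<open>\<sigma>bar\<close> gives both the right linearity of \<open>dual_form\<close> and
  the first half of the formula for \<open>\<partial>\<^sub>i\<^sup>\<sigma>\<close>.
\<close>

lemma sum_bar_mult_sig: "(\<Sum>j\<in>UNIV. \<sigma>bar (x * \<sigma> b $ l $ j) $ k $ j) = \<sigma>bar x $ k $ l * b"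
proof -
  have "(\<Sum>j\<in>UNIV. \<sigma>bar (x * \<sigma> b $ l $ j) $ k $ j)
      = (\<Sum>m\<in>UNIV. \<sigma>bar x $ k $ m * (\<Sum>j\<in>UNIV. \<sigma>bar (\<sigma> b $ l $ j) $ m $ j))"
    unfolding bar_mult_nth sum_distrib_left by (rule sum.swap)
  then show ?thesis
    by (simp add: bar_sig sum_mult_delta)
qed

lemma sum_bar_hat_mult: "(\<Sum>k\<in>UNIV. \<sigma>bar (\<sigma>hat a $ k $ i * x) $ k $ j) = a * \<sigma>bar x $ i $ j"
proof -
  have "(\<Sum>k\<in>UNIV. \<sigma>bar (\<sigma>hat a $ k $ i * x) $ k $ j)
      = (\<Sum>m\<in>UNIV. (\<Sum>k\<in>UNIV. \<sigma>bar (\<sigma>hat a $ k $ i) $ k $ m) * \<sigma>bar x $ m $ j)"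
    unfolding bar_mult_nth sum_distrib_right by (rule sum.swap)
  then show ?thesis
    by (simp add: bar_hat sum_mult_delta)
qed

lemma dual_form_omega: "dual_form \<sigma>bar i a (omega j) = (if j = i then a else 0)"
proof -
  have "\<sigma>bar (omega j $ m) $ i $ m = (if m = j then if j = i then 1 else 0 else 0)" for m
    by (auto simp: omega_def axis_def bar.map_one bar.zero mat_def)
  then show ?thesis
    by (simp add: dual_form_def)
qed

lemma dual_form_in_form_Hom: "dual_form \<sigma>bar i a \<in> form_Hom \<sigma>"
proof -
  have "dual_form \<sigma>bar i a (v + w) = dual_form \<sigma>bar i a v + dual_form \<sigma>bar i a w" for v w
    by (simp add: dual_form_def bar.add sum.distrib distrib_left)
  moreover have "dual_form \<sigma>bar i a (form_right_action \<sigma> w b) = dual_form \<sigma>bar i a w * b" for w b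
  proof -
    have "(\<Sum>j\<in>UNIV. \<sigma>bar (form_right_action \<sigma> w b $ j) $ i $ j)
        = (\<Sum>m\<in>UNIV. \<Sum>j\<in>UNIV. \<sigma>bar (w $ m * \<sigma> b $ m $ j) $ i $ j)"
      unfolding form_right_action_nth bar_sum_nth by (rule sum.swap)
    also have "\<dots> = (\<Sum>m\<in>UNIV. \<sigma>bar (w $ m) $ i $ m) * b"
      by (simp add: sum_bar_mult_sig sum_distrib_right)
    finally show ?thesis
      by (simp add: dual_form_def mult.assoc)
  qed
  ultimately show ?thesis
    by (simp add: form_Hom_def)
qed

lemma partial_sigma_in_im_divergence:
  "partial_sigma der \<sigma>bar \<sigma>hat i a \<in> divergence der \<sigma>bar \<sigma>hat ` form_Hom \<sigma>"
proof (rule image_eqI[OF _ dual_form_in_form_Hom])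
  have zero: "partial_sigma der \<sigma>bar \<sigma>hat j 0 = 0" for j
    by (simp add: partial_sigma_def hat.zero der.zero bar.zero)
  have "partial_sigma der \<sigma>bar \<sigma>hat j (if j = i then a else 0)
      = (if j = i then partial_sigma der \<sigma>bar \<sigma>hat i a else 0)" for j
    by (simp add: zero)
  then show "partial_sigma der \<sigma>bar \<sigma>hat i a
      = divergence der \<sigma>bar \<sigma>hat (dual_form \<sigma>bar i a)"
    by (simp add: divergence_def dual_form_omega)
qed

lemma partial_sigma_inner:
  assumes inner: "\<And>b j. der b $ j = (\<Sum>l\<in>UNIV. \<delta> $ l * \<sigma> b $ l $ j) - b * \<delta> $ j"
  shows "partial_sigma der \<sigma>bar \<sigma>hat i a
    = (\<Sum>k\<in>UNIV. \<Sum>l\<in>UNIV. \<sigma>bar (\<delta> $ l) $ k $ l * \<sigma>hat a $ k $ i)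
      - (\<Sum>l\<in>UNIV. a * \<sigma>bar (\<delta> $ l) $ i $ l)"
proof -
  have "partial_sigma der \<sigma>bar \<sigma>hat i a
      = (\<Sum>j\<in>UNIV. \<Sum>k\<in>UNIV. \<Sum>l\<in>UNIV. \<sigma>bar (\<delta> $ l * \<sigma> (\<sigma>hat a $ k $ i) $ l $ j) $ k $ j)
        - (\<Sum>j\<in>UNIV. \<Sum>k\<in>UNIV. \<sigma>bar (\<sigma>hat a $ k $ i * \<delta> $ j) $ k $ j)"
    by (simp add: partial_sigma_def inner bar.diff bar_sum_nth sum_subtractf)
  also have "(\<Sum>j\<in>UNIV. \<Sum>k\<in>UNIV. \<Sum>l\<in>UNIV. \<sigma>bar (\<delta> $ l * \<sigma> (\<sigma>hat a $ k $ i) $ l $ j) $ k $ j)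
      = (\<Sum>k\<in>UNIV. \<Sum>j\<in>UNIV. \<Sum>l\<in>UNIV. \<sigma>bar (\<delta> $ l * \<sigma> (\<sigma>hat a $ k $ i) $ l $ j) $ k $ j)"
    by (rule sum.swap)
  also have "\<dots> = (\<Sum>k\<in>UNIV. \<Sum>l\<in>UNIV. \<Sum>j\<in>UNIV. \<sigma>bar (\<delta> $ l * \<sigma> (\<sigma>hat a $ k $ i) $ l $ j) $ k $ j)"
    by (rule sum.cong[OF refl], rule sum.swap)
  finally show ?thesis
    by (simp add: sum_bar_mult_sig sum_bar_hat_mult)
qed

end

theorem lemma3p3:
  fixes smul :: "'k::field \<Rightarrow> 'a::{ring,monoid_mult} \<Rightarrow> 'a"
    and \<sigma> \<sigma>bar \<sigma>hat :: "'a \<Rightarrow> 'a ^ 'n ^ 'n"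
    and \<delta> :: "'a ^ 'n"
    and der :: "'a \<Rightarrow> 'a ^ 'n"
  assumes "k_algebra smul"
    and "matrix_algebra_map smul \<sigma>"
    and "\<And>a i. der a $ i = (\<Sum>j\<in>UNIV. \<delta> $ j * \<sigma> a $ j $ i) - a * \<delta> $ i"
    and "free_right_twisted_multi_derivation smul der \<sigma> \<sigma>bar \<sigma>hat"
  shows "\<forall>a i. integral_map der \<sigma> \<sigma>bar \<sigma>hat
        (\<Sum>k\<in>UNIV. \<Sum>l\<in>UNIV. \<sigma>bar (\<delta> $ l) $ k $ l * \<sigma>hat a $ k $ i)
      = integral_map der \<sigma> \<sigma>bar \<sigma>hat (\<Sum>l\<in>UNIV. a * \<sigma>bar (\<delta> $ l) $ i $ l)"
proof -
  interpret free_right_twisted_multi_derivation smul der \<sigma> \<sigma>bar \<sigma>hat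
    by (fact assms(4))
  show ?thesis
    using partial_sigma_in_im_divergence
    by (simp only: integral_map_eq_iff partial_sigma_inner[OF assms(3)] simp_thms)
qed

end
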